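(* Let $\mathscr Y_{\nu_2}$ be the rational-ray visibility datum of the quadratic Veronese cone in $\mathbb A^6$, i.e. of the variety of symmetric $3\times3$ matrices $$M=\begin{pmatrix} x_{11} & x_{12} & x_{13} \\ x_{12} & x_{22} & x_{23} \\ x_{13} & x_{23} & x_{33} \end{pmatrix}$$ all of whose $2\times2$ minors vanish, with coordinates the six entries $(x_{11},x_{22},x_{33},x_{12},x_{13},x_{23})$. Then $$\mathfrak d^{\mathrm{vis}}(\mathscr Y_{\nu_2})=\frac1{\zeta(3/2)},\qquad \mathfrak d_p^{\mathrm{vis}}(\mathscr Y_{\nu_2})=1-p^{-3/2}$$ for every prime $p$. Visibility is locally detectable (a branch point is globally visible if and only if it is $p$-adically visible for every prime $p$), and the global density is the Euler product of the local densities, $\mathfrak d^{\mathrm{vis}}(\mathscr Y_{\nu_2})=\prod_p\mathfrak d_p^{\mathrm{vis}}(\mathscr Y_{\nu_2})$.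
   Context: Rational-ray datum of a homogeneous affine variety $V\subseteq\mathbb A^n$ over $\mathbb Q$: for every class $[v]\in(V(\mathbb Q)\cap\mathbb Q_{>0}^n)/\mathbb Q_{>0}$ choose a representative $v$ and take the ordered branch $\phi_{[v]}(t)=tv$, $t>0$. The branch locus is $\mathcal B=V(\mathbb Z)\cap\mathbb Z_{>0}^n$. For $P\in\mathbb Z^n$, $v_p(P)=\min_iv_p(P_i)$ and $H(P)=\max_i|P_i|$. A branch point $\phi_{[v]}(t)$ is globally visible if there is no real $s$ with $0<s<t$ and $\phi_{[v]}(s)\in\mathbb Z^n$; it is $p$-adically visible if $v_p(\phi_{[v]}(t))\le v_p(\phi_{[v]}(s))$ for all such $s$. $\mathfrak d^{\mathrm{vis}}$ (resp. $\mathfrak d_p^{\mathrm{vis}}$) is the limit as $X\to\infty$ of the proportion of globally visible (resp. $p$-adically visible) points among the points of $\mathcal B$ with $H\le X$. $\zeta$ is the Riemann zeta function. *)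

theory Defs
  imports "HOL-Analysis.Analysis" "HOL-Library.Extended_Nat" "HOL-Computational_Algebra.Primes"
begin

definition rat_point :: "int ^ 'n \<Rightarrow> rat ^ 'n" where
  "rat_point P = (\<chi> i. of_int (P $ i))"

definition real_point :: "int ^ 'n \<Rightarrow> real ^ 'n" where
  "real_point P = (\<chi> i. of_int (P $ i))"

text \<open>The library's \<^const>\<open>multiplicity\<close> is \<open>0\<close> at \<open>0\<close>; the usual convention is infinity.\<close>

definition int_val :: "nat \<Rightarrow> int \<Rightarrow> enat" where
  "int_val p x = (if x = 0 then \<infinity> else enat (multiplicity (int p) x))"

definition point_val :: "nat \<Rightarrow> int ^ 'n \<Rightarrow> enat" where
  "point_val p P = Min (range (\<lambda>i. int_val p (P $ i)))"

definition height :: "int ^ 'n \<Rightarrow> int" where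
  "height P = Max (range (\<lambda>i. \<bar>P $ i\<bar>))"

text \<open>A homogeneous affine variety \<open>V\<close> over the rationals enters only through its set of
  rational points, which is what the argument \<open>V\<close> below stands for; its integral points are the
  integral vectors among them.\<close>

definition pos_rat_points :: "(rat ^ 'n) set \<Rightarrow> (rat ^ 'n) set" where
  "pos_rat_points V = {v \<in> V. \<forall>i. v $ i > 0}"

definition ray_rel :: "(rat ^ 'n) set \<Rightarrow> (rat ^ 'n) rel" where
  "ray_rel V = {(v, w). v \<in> pos_rat_points V \<and> w \<in> pos_rat_points V \<and> (\<exists>c>0. w = c *s v)}"

definition rays :: "(rat ^ 'n) set \<Rightarrow> (rat ^ 'n) set set" where
  "rays V = pos_rat_points V // ray_rel V"

definition is_ray_choice :: "(rat ^ 'n) set \<Rightarrow> ((rat ^ 'n) set \<Rightarrow> rat ^ 'n) \<Rightarrow> bool" where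
  "is_ray_choice V rep \<longleftrightarrow> (\<forall>C \<in> rays V. rep C \<in> C)"

definition branch :: "((rat ^ 'n) set \<Rightarrow> rat ^ 'n) \<Rightarrow> (rat ^ 'n) set \<Rightarrow> real \<Rightarrow> real ^ 'n" where
  "branch rep C t = t *\<^sub>R (\<chi> i. of_rat (rep C $ i))"

definition branch_locus :: "(rat ^ 'n) set \<Rightarrow> (int ^ 'n) set" where
  "branch_locus V = {P. rat_point P \<in> V \<and> (\<forall>i. P $ i > 0)}"

definition globally_visible ::
  "((rat ^ 'n) set \<Rightarrow> rat ^ 'n) \<Rightarrow> (rat ^ 'n) set \<Rightarrow> real \<Rightarrow> bool" where
  "globally_visible rep C t \<longleftrightarrow>
     (\<exists>P. branch rep C t = real_point P) \<and>
     \<not> (\<exists>s. 0 < s \<and> s < t \<and> (\<exists>Q. branch rep C s = real_point Q))"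

definition padically_visible ::
  "((rat ^ 'n) set \<Rightarrow> rat ^ 'n) \<Rightarrow> nat \<Rightarrow> (rat ^ 'n) set \<Rightarrow> real \<Rightarrow> bool" where
  "padically_visible rep p C t \<longleftrightarrow>
     (\<exists>P. branch rep C t = real_point P \<and>
       (\<forall>s Q. 0 < s \<and> s < t \<and> branch rep C s = real_point Q \<longrightarrow> point_val p P \<le> point_val p Q))"

text \<open>A point of the branch locus inherits visibility from its (unique) branch parameters.\<close>

definition globally_visible_points ::
  "(rat ^ 'n) set \<Rightarrow> ((rat ^ 'n) set \<Rightarrow> rat ^ 'n) \<Rightarrow> (int ^ 'n) set" where
  "globally_visible_points V rep =
     {P \<in> branch_locus V. \<exists>C \<in> rays V. \<exists>t>0. branch rep C t = real_point P \<and> globally_visible rep C t}"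

definition padically_visible_points ::
  "(rat ^ 'n) set \<Rightarrow> ((rat ^ 'n) set \<Rightarrow> rat ^ 'n) \<Rightarrow> nat \<Rightarrow> (int ^ 'n) set" where
  "padically_visible_points V rep p =
     {P \<in> branch_locus V. \<exists>C \<in> rays V. \<exists>t>0. branch rep C t = real_point P \<and> padically_visible rep p C t}"

definition locally_detectable ::
  "(rat ^ 'n) set \<Rightarrow> ((rat ^ 'n) set \<Rightarrow> rat ^ 'n) \<Rightarrow> bool" where
  "locally_detectable V rep \<longleftrightarrow>
     (\<forall>C \<in> rays V. \<forall>t>0. (\<exists>P \<in> branch_locus V. branch rep C t = real_point P) \<longrightarrow>
        (globally_visible rep C t \<longleftrightarrow> (\<forall>p. prime p \<longrightarrow> padically_visible rep p C t)))"

definition proportion :: "(rat ^ 'n) set \<Rightarrow> (int ^ 'n) set \<Rightarrow> real \<Rightarrow> real" where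
  "proportion V A X =
     real (card {P \<in> branch_locus V \<inter> A. real_of_int (height P) \<le> X}) /
     real (card {P \<in> branch_locus V. real_of_int (height P) \<le> X})"

definition has_density :: "(rat ^ 'n) set \<Rightarrow> (int ^ 'n) set \<Rightarrow> real \<Rightarrow> bool" where
  "has_density V A d \<longleftrightarrow> (proportion V A \<longlongrightarrow> d) at_top"

text \<open>The densities as numbers; these carry information only where the limits exist.\<close>

definition vis_density :: "(rat ^ 'n) set \<Rightarrow> ((rat ^ 'n) set \<Rightarrow> rat ^ 'n) \<Rightarrow> real" where
  "vis_density V rep = Lim at_top (proportion V (globally_visible_points V rep))"

definition local_vis_density ::
  "(rat ^ 'n) set \<Rightarrow> ((rat ^ 'n) set \<Rightarrow> rat ^ 'n) \<Rightarrow> nat \<Rightarrow> real" where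
  "local_vis_density V rep p = Lim at_top (proportion V (padically_visible_points V rep p))"

text \<open>The Riemann zeta function on the real half-line \<open>s > 1\<close>, given by its Dirichlet series.\<close>

definition zeta :: "real \<Rightarrow> real" where
  "zeta s = (\<Sum>n. 1 / real (Suc n) powr s)"

text \<open>The coordinates of affine 6-space are ordered as
  \<open>(x\<^sub>1\<^sub>1, x\<^sub>2\<^sub>2, x\<^sub>3\<^sub>3, x\<^sub>1\<^sub>2, x\<^sub>1\<^sub>3, x\<^sub>2\<^sub>3)\<close>. (In the index type \<open>6\<close> the numeral \<open>6\<close> equals \<open>0\<close>, so
  \<open>1, \<dots>, 6\<close> are its six distinct elements.)\<close>

definition sym_matrix :: "rat ^ 6 \<Rightarrow> rat ^ 3 ^ 3" where
  "sym_matrix x = vector [vector [x $ 1, x $ 4, x $ 5],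
                          vector [x $ 4, x $ 2, x $ 6],
                          vector [x $ 5, x $ 6, x $ 3]]"

definition minor2 :: "rat ^ 3 ^ 3 \<Rightarrow> 3 \<Rightarrow> 3 \<Rightarrow> 3 \<Rightarrow> 3 \<Rightarrow> rat" where
  "minor2 M i j k l = det (vector [vector [M $ i $ k, M $ i $ l],
                                   vector [M $ j $ k, M $ j $ l]] :: rat ^ 2 ^ 2)"

definition veronese_cone :: "(rat ^ 6) set" where
  "veronese_cone = {x. \<forall>i j k l. i \<noteq> j \<and> k \<noteq> l \<longrightarrow> minor2 (sym_matrix x) i j k l = 0}"

end

theory Submission
  imports Defs "HOL-Computational_Algebra.Squarefree"
begin

text \<open>
  On the ray through an integral point \<open>P\<close> with positive coordinates, the parameter values that give
  integral points are the multiples of a single one, at which the point is the primitive vector on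
  the ray. If \<open>P\<close> is \<open>e\<close> times that vector, then the earlier integral points are its multiples by
  \<open>1, \<dots>, e - 1\<close>, so \<open>P\<close> is globally visible iff \<open>e = 1\<close>; and since the first of these multiples
  has valuation \<open>0\<close>, \<open>P\<close> is \<open>p\<close>-adically visible iff \<open>p\<close> does not divide \<open>e\<close>
  (\<open>globally_visible_iff\<close>, \<open>padically_visible_iff\<close>). Local detectability is then the fact that
  an integer at least \<open>2\<close> has a prime divisor.

  The densities follow, for any cone, from the order of growth of its point count. Write \<open>N(X)\<close> for
  the number of points of the branch locus of height at most \<open>X\<close> and suppose that
  \<open>N(X) / X\<^sup>s\<close> tends to some nonzero \<open>\<kappa>\<close>, where \<open>s > 1\<close>. Division by \<open>p\<close> matches the points divisible by
  \<open>p\<close> with those of height at most \<open>X / p\<close>, so they have density \<open>p\<^sup>-\<^sup>s\<close>. Sieving by the primes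
  below \<open>m\<close> one after the other leaves the density \<open>\<Prod>\<^bsub>p < m\<^esub> (1 - p\<^sup>-\<^sup>s)\<close>
  (\<open>rough_points_growth\<close>). The points that survive this sieve without being primitive number at most
  \<open>\<Sum>\<^bsub>k \<ge> m\<^esub> N(X / k)\<close>, which is at most a constant times
  \<open>X\<^sup>s\<close> times the tail of a convergent series; so \<open>m\<close> may tend to
  infinity, and by Euler's product the primitive points have density \<open>1 / \<zeta>(s)\<close>
  (\<open>primitive_points_growth\<close>).

  For the Veronese cone \<open>s = 3/2\<close>. Its points with positive integral coordinates are the matrices
  \<open>d u u\<^sup>T\<close> with \<open>d\<close> squarefree and \<open>u\<close> a vector of three positive integers, in a unique way
  (\<open>branch_locus_veronese\<close>, \<open>inj_on_veronese_point\<close>), and the height of such a point is \<open>d\<close> times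
  the square of the largest entry of \<open>u\<close>. Hence \<open>N(X)\<close> is the sum of \<open>\<lfloor>\<surd>(X / d)\<rfloor>\<^sup>3\<close> over squarefree
  \<open>d\<close>, and dominated convergence gives the limit \<open>\<kappa> = \<Sum> d\<^sup>-\<^sup>3\<^sup>/\<^sup>2\<close> over squarefree \<open>d\<close>
  (\<open>count_points_veronese_growth\<close>).
\<close>

section \<open>Euler product for the zeta function\<close>

text \<open>The \<open>m\<close>-rough numbers of sieve theory. The bound on \<open>p\<close> is strict so that the step from \<open>m\<close>
  to \<open>m + 1\<close> sieves by \<open>m\<close>.\<close>

definition rough :: "nat \<Rightarrow> nat \<Rightarrow> bool" where
  "rough m n \<longleftrightarrow> (\<forall>p. prime p \<and> p < m \<longrightarrow> \<not> p dvd n)"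

text \<open>The value \<open>1\<close> at indices that are not prime lets products run over all indices below a bound.\<close>

definition euler_factor :: "real \<Rightarrow> nat \<Rightarrow> real" where
  "euler_factor s p = (if prime p then 1 - real p powr (- s) else 1)"

lemma summable_powr_neg: "1 < s \<Longrightarrow> summable (\<lambda>n. real n powr (- s))"
  using summable_real_powr_iff[of "- s"] by simp

text \<open>The series may start at \<open>0\<close> because \<open>0 powr (- s) = 0\<close>. In this form the substitution
  \<open>n = p * k\<close> can be carried out without an index shift.\<close>

lemma zeta_eq_suminf_powr:
  assumes "1 < s"
  shows "zeta s = (\<Sum>n. real n powr (- s))"
  using suminf_split_head[OF summable_powr_neg[OF assms]]
  by (simp add: zeta_def powr_minus_divide)

lemma zeta_ge_1:
  assumes "1 < s"
  shows "1 \<le> zeta s"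
proof -
  have "(\<Sum>n\<in>{1}. real n powr (- s)) \<le> (\<Sum>n. real n powr (- s))"
    by (rule sum_le_suminf[OF summable_powr_neg[OF assms]]) auto
  then show ?thesis using zeta_eq_suminf_powr[OF assms] by simp
qed

lemma rough_Suc_prime:
  assumes "prime m"
  shows "rough (Suc m) n \<longleftrightarrow> rough m n \<and> \<not> m dvd n"
  using assms by (auto simp: rough_def less_Suc_eq)

lemma rough_Suc_nonprime:
  assumes "\<not> prime m"
  shows "rough (Suc m) n \<longleftrightarrow> rough m n"
  using assms by (auto simp: rough_def less_Suc_eq)

lemma rough_prime_mult:
  assumes "prime m"
  shows "rough m (m * k) \<longleftrightarrow> rough m k"
proof -
  have "p dvd m * k \<longleftrightarrow> p dvd k" if "prime p" "p < m" for p
    using that assms primes_dvd_imp_eq[of p m] prime_dvd_mult_iff[of p m k] by auto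
  then show ?thesis unfolding rough_def by blast
qed

lemma rough_imp_ge:
  assumes "rough m n" "n \<noteq> 1"
  shows "n = 0 \<or> m \<le> n"
proof (rule ccontr)
  assume "\<not> (n = 0 \<or> m \<le> n)"
  then have n: "0 < n" "n < m" by auto
  obtain p where p: "prime p" "p dvd n" using assms(2) prime_factor_nat by blast
  with n have "p < m" using dvd_imp_le[of p n] by linarith
  with p assms(1) show False by (auto simp: rough_def)
qed

lemma summable_rough:
  "1 < s \<Longrightarrow> summable (\<lambda>n. if rough m n then real n powr (- s) else 0)"
  by (rule summable_comparison_test'[OF summable_powr_neg[of s], where N = 0]) auto

text \<open>The sieve behind Euler's product: passing from \<open>m\<close> to \<open>m + 1\<close> matters only for a prime \<open>m\<close>, and
  then it removes the terms \<open>n = m * k\<close> with \<open>k\<close> again \<open>m\<close>-rough, whose sum is \<open>m powr (- s)\<close>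
  times the sum before the removal.\<close>

lemma rough_sum_eq:
  assumes s: "1 < s"
  shows "(\<Sum>n. if rough m n then real n powr (- s) else 0) = zeta s * (\<Prod>p<m. euler_factor s p)"
proof (induction m)
  case 0
  then show ?case by (simp add: rough_def zeta_eq_suminf_powr[OF s])
next
  case (Suc m)
  show ?case
  proof (cases "prime m")
    case False
    then show ?thesis using Suc by (simp add: rough_Suc_nonprime euler_factor_def)
  next
    case True
    let ?f = "\<lambda>n. if rough m n then real n powr (- s) else 0"
    let ?g = "\<lambda>n. if m dvd n then ?f n else 0"
    have mono: "strict_mono (\<lambda>k. m * k)"
      using True by (auto simp: strict_mono_def prime_gt_0_nat)
    have sg: "summable ?g"
      by (rule summable_comparison_test'[OF summable_rough[OF s], where N = 0]) auto
    have "suminf ?g = (\<Sum>k. ?g (m * k))"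
      by (rule suminf_mono_reindex[OF mono, symmetric]) (auto elim: dvdE)
    also have "\<dots> = (\<Sum>k. real m powr (- s) * ?f k)"
      using True by (intro suminf_cong) (simp add: rough_prime_mult powr_mult)
    also have "\<dots> = real m powr (- s) * suminf ?f"
      by (rule suminf_mult[OF summable_rough[OF s]])
    finally have g: "suminf ?g = real m powr (- s) * suminf ?f" .
    have "(\<Sum>n. if rough (Suc m) n then real n powr (- s) else 0) = (\<Sum>n. ?f n - ?g n)"
      using True by (intro suminf_cong) (auto simp: rough_Suc_prime)
    also have "\<dots> = suminf ?f - suminf ?g"
      by (rule suminf_diff[OF summable_rough[OF s] sg, symmetric])
    finally show ?thesis using Suc g True by (simp add: euler_factor_def algebra_simps)
  qed
qed

lemma powr_tail_tendsto_0:
  assumes "1 < s"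
  shows "(\<lambda>m. \<Sum>k. real (k + m) powr (- s)) \<longlonglongrightarrow> 0"
  using suminf_exist_split2[OF summable_powr_neg[OF assms]] by simp

text \<open>Only the term \<open>n = 1\<close> survives in the limit, since every other \<open>n > 0\<close> fails to be \<open>m\<close>-rough as
  soon as \<open>m > n\<close>; the zeta series dominates.\<close>

lemma rough_sum_tendsto_1:
  assumes s: "1 < s"
  shows "(\<lambda>m. \<Sum>n. if rough m n then real n powr (- s) else 0) \<longlonglongrightarrow> 1"
proof -
  have "(\<lambda>m. \<Sum>n. if rough m n then real n powr (- s) else 0) \<longlonglongrightarrow>
        (\<Sum>n. if n = 1 then 1 else (0::real))"
  proof (rule tannerys_theorem[THEN conjunct2, THEN conjunct2])
    fix n :: nat
    have "(if rough m n then real n powr (- s) else 0) = (if n = 1 then 1 else 0)"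
      if "n < m" for m
      using rough_imp_ge[of m n] that
      by (cases "n = 0") (auto simp: rough_def)
    then show "(\<lambda>m. if rough m n then real n powr (- s) else 0) \<longlonglongrightarrow> (if n = 1 then 1 else 0)"
      by (intro tendsto_eventually eventually_mono[OF eventually_gt_at_top[of n]]) auto
  next
    show "\<forall>\<^sub>F (n, m) in at_top \<times>\<^sub>F sequentially.
      norm (if rough m n then real n powr (- s) else 0) \<le> real n powr (- s)"
      by (intro always_eventually) auto
  qed (auto simp: summable_powr_neg[OF s])
  also have "(\<Sum>n. if n = 1 then 1 else (0::real)) = 1"
    using suminf_finite[of "{1::nat}" "\<lambda>n. if n = 1 then 1 else (0::real)"] by simp
  finally show ?thesis .
qed

text \<open>The \<open>m\<close>-rough part of the zeta series equals \<open>zeta s\<close> times the partial product, and it tends to \<open>1\<close>.\<close>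

lemma euler_product_tendsto:
  assumes s: "1 < s"
  shows "(\<lambda>m. \<Prod>p<m. euler_factor s p) \<longlonglongrightarrow> 1 / zeta s"
proof -
  have z: "zeta s \<noteq> 0" using zeta_ge_1[OF s] by simp
  have "(\<lambda>m. (\<Sum>n. if rough m n then real n powr (- s) else 0) / zeta s) \<longlonglongrightarrow> 1 / zeta s"
    by (intro tendsto_divide rough_sum_tendsto_1[OF s] tendsto_const z)
  then show ?thesis using z by (simp add: rough_sum_eq[OF s])
qed

lemma euler_product_has_prod:
  assumes s: "1 < s"
  shows "euler_factor s has_prod (1 / zeta s)"
proof -
  have "(\<lambda>n. \<Prod>p\<le>n. euler_factor s p) \<longlonglongrightarrow> 1 / zeta s"
    using LIMSEQ_Suc[OF euler_product_tendsto[OF s]] by (simp add: lessThan_Suc_atMost)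
  then show ?thesis using zeta_ge_1[OF s] by (simp add: has_prod_def raw_has_prod_def)
qed

section \<open>Visibility and divisibility\<close>

definition divides_point :: "nat \<Rightarrow> int ^ 'n \<Rightarrow> bool" where
  "divides_point k P \<longleftrightarrow> (\<forall>i. int k dvd P $ i)"

text \<open>A ray through \<open>P\<close> can be parametrized by \<open>P\<close> itself, so that visibility of \<open>P\<close> depends neither on
  the chosen representative nor on the ray as a set.\<close>

lemma branch_rescale:
  fixes rep :: "(rat ^ 'n) set \<Rightarrow> rat ^ 'n"
  assumes "branch rep C t = real_point P" "t > 0"
  shows "branch rep C s = real_point Q \<longleftrightarrow> (\<forall>i. of_int (Q $ i) = s / t * of_int (P $ i))"
proof -
  have "t * of_rat (rep C $ i) = of_int (P $ i)" for i
    using assms(1) by (simp add: branch_def real_point_def vec_eq_iff)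
  then have "of_rat (rep C $ i) = of_int (P $ i) / t" for i
    using assms(2) by (simp add: field_simps)
  then show ?thesis by (auto simp: branch_def real_point_def vec_eq_iff)
qed

text \<open>Each positive integral point of \<open>V\<close> lies on the branch of the class of the point itself.\<close>

lemma branch_through_point:
  fixes rep :: "(rat ^ 'n) set \<Rightarrow> rat ^ 'n"
  assumes rep: "is_ray_choice V rep" and P: "P \<in> branch_locus V"
  obtains C t where "C \<in> rays V" "t > 0" "branch rep C t = real_point P"
proof -
  let ?C = "ray_rel V `` {rat_point P}"
  have "rat_point P \<in> pos_rat_points V"
    using P by (auto simp: branch_locus_def pos_rat_points_def rat_point_def)
  then have C: "?C \<in> rays V" by (auto simp: rays_def intro: quotientI)
  with rep have "(rat_point P, rep ?C) \<in> ray_rel V" by (auto simp: is_ray_choice_def)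
  then obtain c where c: "c > 0" "rep ?C = c *s rat_point P" by (auto simp: ray_rel_def)
  have "branch rep ?C (1 / of_rat c) = real_point P"
    using c by (simp add: branch_def real_point_def vec_eq_iff rat_point_def of_rat_mult)
  then show thesis using that[OF C, of "1 / of_rat c"] c by simp
qed

text \<open>An earlier integral point is \<open>Q = (s / t) P\<close>, and \<open>s / t\<close> is rational because the coordinates of
  \<open>P\<close> are nonzero. In lowest terms its denominator is at least \<open>2\<close>, as \<open>0 < s / t < 1\<close>, and it
  divides every coordinate of \<open>P\<close>. Conversely, if \<open>k\<close> divides \<open>P\<close>, then \<open>P / k\<close> is an earlier
  integral point.\<close>

lemma globally_visible_iff:
  fixes rep :: "(rat ^ 'n) set \<Rightarrow> rat ^ 'n"
  assumes b: "branch rep C t = real_point P" and t: "t > 0" and pos: "\<And>i. P $ i > 0"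
  shows "globally_visible rep C t \<longleftrightarrow> (\<forall>k\<ge>2. \<not> divides_point k P)"
proof -
  have "(\<exists>s. 0 < s \<and> s < t \<and> (\<exists>Q. branch rep C s = real_point Q)) \<longleftrightarrow> (\<exists>k\<ge>2. divides_point k P)"
  proof (intro iffI; elim exE conjE)
    fix s Q assume s: "0 < s" "s < t" and "branch rep C s = real_point Q"
    then have Q: "of_int (Q $ i) = s / t * of_int (P $ i)" for i
      using branch_rescale[OF b t] by blast
    \<comment> \<open>One coordinate suffices to write \<open>s / t\<close> as the fraction \<open>a / d\<close> of integers.\<close>
    fix i0 :: 'n
    define a where "a = Q $ i0"
    define d where "d = P $ i0"
    have d: "d > 0" using pos by (simp add: d_def)
    have st: "s / t = of_int a / of_int d"
      using Q[of i0] d by (simp add: a_def d_def field_simps)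
    have cross: "d * Q $ i = a * P $ i" for i
    proof -
      have "(of_int (d * Q $ i) :: real) = of_int (a * P $ i)"
        using Q[of i] d unfolding st by (simp add: field_simps)
      then show ?thesis by linarith
    qed
    have "of_int a / (of_int d :: real) < 1" "0 < of_int a / (of_int d :: real)"
      using s t unfolding st[symmetric] by simp_all
    with d have a: "0 < a" "a < d" by (simp_all add: field_simps zero_less_divide_iff)
    define g where "g = gcd a d"
    have g: "g > 0" using d by (simp add: g_def)
    obtain a' d' where ad: "a = a' * g" "d = d' * g" "coprime a' d'"
      using gcd_coprime_exists[of a d] g unfolding g_def by fastforce
    have "d' * Q $ i = a' * P $ i" for i using cross[of i] g ad by simp
    then have "d' dvd a' * P $ i" for i by (metis dvd_triv_left)
    then have "d' dvd P $ i" for i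
      using ad(3) coprime_commute coprime_dvd_mult_right_iff by blast
    moreover have "d' \<ge> 2"
    proof -
      have "0 < a'" "a' < d'" using a g ad by (simp_all add: zero_less_mult_iff)
      then show ?thesis by linarith
    qed
    ultimately show "\<exists>k\<ge>2. divides_point k P"
      by (intro exI[of _ "nat d'"]) (auto simp: divides_point_def)
  next
    fix k :: nat assume k: "2 \<le> k" "divides_point k P"
    then have "real k * of_int (P $ i div int k) = of_int (P $ i)" for i
      unfolding divides_point_def
      by (metis dvd_mult_div_cancel of_int_mult of_int_of_nat_eq)
    then have "branch rep C (t / k) = real_point (\<chi> i. P $ i div int k)"
      using k t unfolding branch_rescale[OF b t] by (auto simp: field_simps)
    then show "\<exists>s. 0 < s \<and> s < t \<and> (\<exists>Q. branch rep C s = real_point Q)"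
      using k t by (intro exI[of _ "t / k"]) (auto simp: field_simps)
  qed
  then show ?thesis using b unfolding globally_visible_def by blast
qed

lemma point_val_eq_0:
  fixes P :: "int ^ 'n"
  assumes "prime p" "\<not> divides_point p P"
  shows "point_val p P = 0"
proof -
  obtain i where i: "\<not> int p dvd P $ i" using assms(2) by (auto simp: divides_point_def)
  then have "int_val p (P $ i) = 0"
    by (auto simp: int_val_def not_dvd_imp_multiplicity_0 zero_enat_def)
  moreover have "point_val p P \<le> int_val p (P $ i)"
    unfolding point_val_def by (rule Min_le) auto
  ultimately show ?thesis by simp
qed

lemma int_val_prime_mult:
  assumes "prime p" "x \<noteq> 0"
  shows "int_val p (int p * x) = eSuc (int_val p x)"
  using assms prime_gt_1_nat[OF assms(1)]
  by (auto simp: int_val_def multiplicity_times_same eSuc_enat)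

text \<open>Positivity of \<open>Q\<close> makes its valuation finite, so that adding \<open>1\<close> increases it.\<close>

lemma point_val_quotient_less:
  fixes P Q :: "int ^ 'n"
  assumes p: "prime p" and pos: "\<And>i. Q $ i > 0" and PQ: "\<And>i. P $ i = int p * Q $ i"
  shows "point_val p Q < point_val p P"
proof -
  have "point_val p P \<in> range (\<lambda>i. int_val p (P $ i))"
    unfolding point_val_def by (rule Min_in) auto
  then obtain i where i: "point_val p P = int_val p (P $ i)" by auto
  have "point_val p Q \<le> int_val p (Q $ i)"
    unfolding point_val_def by (rule Min_le) auto
  also have "\<dots> < eSuc (int_val p (Q $ i))"
    using pos[of i] by (auto simp: int_val_def eSuc_enat)
  also have "\<dots> = point_val p P"
    using i PQ int_val_prime_mult[OF p, of "Q $ i"] pos[of i] by simp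
  finally show ?thesis .
qed

text \<open>If \<open>p\<close> divides \<open>P\<close>, then \<open>P / p\<close> is an earlier integral point with a smaller valuation. Otherwise
  the valuation of \<open>P\<close> is \<open>0\<close>, the least possible.\<close>

lemma padically_visible_iff:
  fixes rep :: "(rat ^ 'n) set \<Rightarrow> rat ^ 'n"
  assumes b: "branch rep C t = real_point P" and t: "t > 0" and pos: "\<And>i. P $ i > 0"
    and p: "prime p"
  shows "padically_visible rep p C t \<longleftrightarrow> \<not> divides_point p P"
proof
  have unique: "P' = P" if "branch rep C t = real_point P'" for P'
    using that b by (simp add: real_point_def vec_eq_iff)
  assume vis: "padically_visible rep p C t"
  show "\<not> divides_point p P"
  proof
    assume "divides_point p P"
    define Q where "Q = (\<chi> i. P $ i div int p)"
    have PQ: "P $ i = int p * Q $ i" for i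
      using \<open>divides_point p P\<close> by (simp add: Q_def divides_point_def)
    have p1: "1 < p" using p by (rule prime_gt_1_nat)
    have Qpos: "Q $ i > 0" for i using pos[of i] p1 by (simp add: PQ zero_less_mult_iff)
    have "branch rep C (t / p) = real_point Q"
      using p1 t unfolding branch_rescale[OF b t] by (simp add: PQ)
    moreover have "t / p < t" "0 < t / p" using p1 t by (simp_all add: field_simps)
    ultimately have "point_val p P \<le> point_val p Q"
      using vis unique unfolding padically_visible_def by blast
    with point_val_quotient_less[OF p Qpos PQ] show False by simp
  qed
next
  assume "\<not> divides_point p P"
  then show "padically_visible rep p C t"
    using b point_val_eq_0[OF p] unfolding padically_visible_def by fastforce
qed

lemma divides_point_prime_divisor:
  "(\<exists>k\<ge>2. divides_point k P) \<longleftrightarrow> (\<exists>p. prime p \<and> divides_point p P)"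
proof
  assume "\<exists>k\<ge>2. divides_point k P"
  then obtain k where k: "k \<ge> 2" "divides_point k P" by blast
  then obtain p where "prime p" "p dvd k" using prime_factor_nat[of k] by auto
  with k show "\<exists>p. prime p \<and> divides_point p P"
    unfolding divides_point_def by (meson dvd_trans of_nat_dvd_iff)
next
  assume "\<exists>p. prime p \<and> divides_point p P"
  then show "\<exists>k\<ge>2. divides_point k P" using prime_ge_2_nat by blast
qed

text \<open>Some \<open>k \<ge> 2\<close> divides \<open>P\<close> iff some prime divides \<open>P\<close>.\<close>

lemma locally_detectable_always:
  fixes rep :: "(rat ^ 'n) set \<Rightarrow> rat ^ 'n"
  shows "locally_detectable V rep"
  unfolding locally_detectable_def
proof (intro ballI allI impI)
  fix C :: "(rat ^ 'n) set" and t :: real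
  assume t: "t > 0" and "\<exists>P\<in>branch_locus V. branch rep C t = real_point P"
  then obtain P where "P \<in> branch_locus V" and b: "branch rep C t = real_point P" by blast
  then have pos: "P $ i > 0" for i by (simp add: branch_locus_def)
  show "globally_visible rep C t \<longleftrightarrow> (\<forall>p. prime p \<longrightarrow> padically_visible rep p C t)"
    using globally_visible_iff[OF b t pos] padically_visible_iff[OF b t pos]
      divides_point_prime_divisor[of P] by blast
qed

lemma globally_visible_points_eq:
  fixes rep :: "(rat ^ 'n) set \<Rightarrow> rat ^ 'n"
  assumes "is_ray_choice V rep"
  shows "globally_visible_points V rep = {P \<in> branch_locus V. \<forall>p. prime p \<longrightarrow> \<not> divides_point p P}"
proof (intro set_eqI iffI)
  fix P assume "P \<in> globally_visible_points V rep"
  then obtain C t where P: "P \<in> branch_locus V" and b: "t > 0" "branch rep C t = real_point P"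
    and vis: "globally_visible rep C t" by (auto simp: globally_visible_points_def)
  have pos: "P $ i > 0" for i using P by (simp add: branch_locus_def)
  show "P \<in> {P \<in> branch_locus V. \<forall>p. prime p \<longrightarrow> \<not> divides_point p P}"
    using globally_visible_iff[OF b(2,1) pos] vis P divides_point_prime_divisor[of P] by blast
next
  fix P assume P: "P \<in> {P \<in> branch_locus V. \<forall>p. prime p \<longrightarrow> \<not> divides_point p P}"
  then obtain C t where b: "C \<in> rays V" "t > 0" "branch rep C t = real_point P"
    using branch_through_point[OF assms] by blast
  have pos: "P $ i > 0" for i using P by (simp add: branch_locus_def)
  show "P \<in> globally_visible_points V rep"
    using globally_visible_iff[OF b(3,2) pos] b P divides_point_prime_divisor[of P]
    unfolding globally_visible_points_def by blast
qed

lemma padically_visible_points_eq: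
  fixes rep :: "(rat ^ 'n) set \<Rightarrow> rat ^ 'n"
  assumes "is_ray_choice V rep" and p: "prime p"
  shows "padically_visible_points V rep p = {P \<in> branch_locus V. \<not> divides_point p P}"
proof (intro set_eqI iffI)
  fix P assume "P \<in> padically_visible_points V rep p"
  then obtain C t where P: "P \<in> branch_locus V" and b: "t > 0" "branch rep C t = real_point P"
    and vis: "padically_visible rep p C t" by (auto simp: padically_visible_points_def)
  have pos: "P $ i > 0" for i using P by (simp add: branch_locus_def)
  show "P \<in> {P \<in> branch_locus V. \<not> divides_point p P}"
    using padically_visible_iff[OF b(2,1) pos p] vis P by blast
next
  fix P assume P: "P \<in> {P \<in> branch_locus V. \<not> divides_point p P}"
  then obtain C t where b: "C \<in> rays V" "t > 0" "branch rep C t = real_point P"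
    using branch_through_point[OF assms(1)] by blast
  have pos: "P $ i > 0" for i using P by (simp add: branch_locus_def)
  show "P \<in> padically_visible_points V rep p"
    using padically_visible_iff[OF b(3,2) pos p] b P
    unfolding padically_visible_points_def by blast
qed

section \<open>Counting points of a cone\<close>

definition count_points :: "(rat ^ 'n) set \<Rightarrow> (int ^ 'n) set \<Rightarrow> real \<Rightarrow> real" where
  "count_points V A X = real (card {P \<in> branch_locus V \<inter> A. real_of_int (height P) \<le> X})"

text \<open>Homogeneity of the variety, as far as positive scalars see it.\<close>

definition is_cone :: "(rat ^ 'n) set \<Rightarrow> bool" where
  "is_cone V \<longleftrightarrow> (\<forall>c>0. \<forall>v\<in>V. c *s v \<in> V)"

definition rough_points :: "nat \<Rightarrow> (int ^ 'n) set" where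
  "rough_points m = {P. \<forall>p. prime p \<and> p < m \<longrightarrow> \<not> divides_point p P}"

text \<open>The limiting case of \<open>rough_points\<close>; by \<open>divides_point_prime_divisor\<close> these are the points whose
  coordinates have no common divisor greater than \<open>1\<close>.\<close>

definition primitive_points :: "(int ^ 'n) set" where
  "primitive_points = {P. \<forall>p. prime p \<longrightarrow> \<not> divides_point p P}"

lemma height_le_iff:
  fixes P :: "int ^ 'n"
  shows "real_of_int (height P) \<le> X \<longleftrightarrow> (\<forall>i. real_of_int \<bar>P $ i\<bar> \<le> X)"
proof -
  have "height P \<le> \<lfloor>X\<rfloor> \<longleftrightarrow> (\<forall>i. \<bar>P $ i\<bar> \<le> \<lfloor>X\<rfloor>)"
    unfolding height_def by (subst Max_le_iff) auto
  then show ?thesis by (simp only: le_floor_iff)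
qed

lemma finite_points_bounded_height:
  fixes V :: "(rat ^ 'n) set"
  shows "finite {P \<in> branch_locus V \<inter> A. real_of_int (height P) \<le> X}"
proof (rule finite_subset)
  let ?F = "PiE (UNIV :: 'n set) (\<lambda>_. {- \<lfloor>X\<rfloor>..\<lfloor>X\<rfloor>})"
  show "finite (vec_lambda ` ?F)" by (intro finite_imageI finite_PiE) auto
  show "{P \<in> branch_locus V \<inter> A. real_of_int (height P) \<le> X} \<subseteq> vec_lambda ` ?F"
  proof
    fix P assume "P \<in> {P \<in> branch_locus V \<inter> A. real_of_int (height P) \<le> X}"
    then have "\<bar>P $ i\<bar> \<le> \<lfloor>X\<rfloor>" for i by (simp add: height_le_iff le_floor_iff)
    then have "(\<lambda>i. P $ i) \<in> ?F" by (auto simp: PiE_def abs_le_iff minus_le_iff)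
    then show "P \<in> vec_lambda ` ?F" by (intro image_eqI[of _ _ "\<lambda>i. P $ i"]) auto
  qed
qed

lemma count_points_mono:
  assumes "A \<subseteq> B" "X \<le> Y"
  shows "count_points V A X \<le> count_points V B Y"
  unfolding count_points_def of_nat_le_iff
  by (rule card_mono[OF finite_points_bounded_height]) (use assms in auto)

lemma count_points_eq_0:
  assumes "X < 1"
  shows "count_points V A X = 0"
proof -
  have "\<not> real_of_int (height P) \<le> X" if "P \<in> branch_locus V" for P
  proof
    assume "real_of_int (height P) \<le> X"
    then have "real_of_int \<bar>P $ i\<bar> < 1" for i
      using assms by (auto simp: height_le_iff intro: le_less_trans)
    moreover have "P $ i > 0" for i using that by (simp add: branch_locus_def)
    ultimately show False by (metis abs_of_pos of_int_less_1_iff int_one_le_iff_zero_less linorder_not_le)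
  qed
  then have "{P \<in> branch_locus V \<inter> A. real_of_int (height P) \<le> X} = {}" by blast
  then show ?thesis by (simp only: count_points_def card.empty)
qed

text \<open>Multiplication by \<open>k\<close> is a bijection from the points of height at most \<open>X / k\<close> onto the points of height at
  most \<open>X\<close> that \<open>k\<close> divides. The condition on \<open>A\<close> and \<open>B\<close> allows the same count after some primes
  have been sieved out.\<close>

lemma count_points_multiples:
  fixes V :: "(rat ^ 'n) set"
  assumes V: "is_cone V" and k: "k > 0"
    and AB: "\<And>Q. (\<chi> i. int k * Q $ i) \<in> A \<longleftrightarrow> Q \<in> B"
  shows "count_points V (A \<inter> {P. divides_point k P}) X = count_points V B (X / real k)"
proof -
  let ?m = "\<lambda>Q. (\<chi> i. int k * Q $ i) :: int ^ 'n"
  let ?L = "{P \<in> branch_locus V \<inter> (A \<inter> {P. divides_point k P}). real_of_int (height P) \<le> X}"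
  let ?R = "{P \<in> branch_locus V \<inter> B. real_of_int (height P) \<le> X / real k}"
  have locus: "?m Q \<in> branch_locus V \<longleftrightarrow> Q \<in> branch_locus V" for Q
  proof -
    have eq: "rat_point (?m Q) = of_nat k *s rat_point Q"
        "rat_point Q = inverse (of_nat k) *s rat_point (?m Q)"
      using k by (simp_all add: rat_point_def vec_eq_iff)
    have "rat_point (?m Q) \<in> V \<longleftrightarrow> rat_point Q \<in> V"
    proof
      assume "rat_point (?m Q) \<in> V"
      then show "rat_point Q \<in> V" using V k by (subst eq(2)) (simp add: is_cone_def)
    next
      assume "rat_point Q \<in> V"
      then show "rat_point (?m Q) \<in> V" using V k by (subst eq(1)) (simp add: is_cone_def)
    qed
    then show ?thesis using k by (simp add: branch_locus_def zero_less_mult_iff)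
  qed
  have height: "real_of_int (height (?m Q)) \<le> X \<longleftrightarrow> real_of_int (height Q) \<le> X / real k" for Q
    using k by (simp add: height_le_iff abs_mult field_simps)
  have "inj ?m" using k by (auto simp: inj_def vec_eq_iff)
  then have "inj_on ?m ?R" by (rule inj_on_subset) simp
  moreover have "?m ` ?R = ?L"
  proof (intro set_eqI iffI)
    fix P assume "P \<in> ?m ` ?R"
    then obtain Q where "Q \<in> ?R" "P = ?m Q" by blast
    then show "P \<in> ?L" using locus height AB by (simp add: divides_point_def)
  next
    fix P assume P: "P \<in> ?L"
    define Q :: "int ^ 'n" where "Q = (\<chi> i. P $ i div int k)"
    have PQ: "P = ?m Q" using P by (simp add: Q_def vec_eq_iff divides_point_def)
    moreover have "Q \<in> ?R" using P locus[of Q] height[of Q] AB[of Q] unfolding PQ by blast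
    ultimately show "P \<in> ?m ` ?R" by blast
  qed
  ultimately have "card ?L = card ?R" using card_image[of ?m ?R] by argo
  then show ?thesis by (simp only: count_points_def)
qed

lemma count_points_split:
  "count_points V A X = count_points V (A \<inter> B) X + count_points V (A - B) X"
proof -
  let ?S = "\<lambda>A. {P \<in> branch_locus V \<inter> A. real_of_int (height P) \<le> X}"
  have "card (?S A) = card (?S (A \<inter> B) \<union> ?S (A - B))" by (rule arg_cong[of _ _ card]) auto
  also have "\<dots> = card (?S (A \<inter> B)) + card (?S (A - B))"
    by (rule card_Un_disjoint[OF finite_points_bounded_height finite_points_bounded_height]) auto
  finally show ?thesis by (simp only: count_points_def of_nat_add)
qed

lemma prime_divides_point_mult:
  assumes "prime p" "prime q"
  shows "divides_point q (\<chi> i. int p * Q $ i) \<longleftrightarrow> q = p \<or> divides_point q Q"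
proof (cases "q = p")
  case False
  then have "\<not> int q dvd int p" using assms primes_dvd_imp_eq by auto
  then show ?thesis using assms False
    by (simp add: divides_point_def prime_dvd_mult_iff)
qed (simp add: divides_point_def)

lemma rough_points_Suc:
  "rough_points (Suc m) = (if prime m then rough_points m - {P. divides_point m P} else rough_points m)"
  by (auto simp: rough_points_def less_Suc_eq)

lemma rough_points_0 [simp]: "rough_points 0 = UNIV"
  by (simp add: rough_points_def)

lemma primitive_subset_rough: "primitive_points \<subseteq> rough_points m"
  by (auto simp: primitive_points_def rough_points_def)

section \<open>Sieving by primes\<close>

lemma rescaled_growth:
  fixes f :: "real \<Rightarrow> real"
  assumes lim: "((\<lambda>X. f X / X powr s) \<longlongrightarrow> L) at_top" and k: "k > 0"
  shows "((\<lambda>X. f (X / real k) / X powr s) \<longlongrightarrow> real k powr (- s) * L) at_top"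
proof -
  have "filterlim (\<lambda>X. X / real k) at_top at_top"
    using k
    by (intro filterlim_at_top_mult_tendsto_pos[where f = "\<lambda>_. 1 / real k" and c = "1 / real k", simplified])
      (auto simp: filterlim_ident)
  then have "((\<lambda>X. f (X / real k) / (X / real k) powr s) \<longlongrightarrow> L) at_top"
    by (rule filterlim_compose[OF lim])
  then have "((\<lambda>X. real k powr (- s) * (f (X / real k) / (X / real k) powr s))
      \<longlongrightarrow> real k powr (- s) * L) at_top"
    by (intro tendsto_mult tendsto_const)
  moreover have "\<forall>\<^sub>F X in at_top. real k powr (- s) * (f (X / real k) / (X / real k) powr s)
      = f (X / real k) / X powr s"
    using eventually_gt_at_top[of 0]
    by eventually_elim (use k in \<open>simp add: powr_divide powr_minus field_simps\<close>)
  ultimately show ?thesis by (rule Lim_transform_eventually)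
qed

text \<open>The step for a prime \<open>m\<close> removes the points \<open>m Q\<close> with \<open>Q\<close> free of divisors among the smaller
  primes, and these are counted by the same function at \<open>X / m\<close>. The induction is parallel to the one
  in \<open>rough_sum_eq\<close>.\<close>

lemma rough_points_growth:
  fixes V :: "(rat ^ 'n) set"
  assumes V: "is_cone V"
    and lim: "((\<lambda>X. count_points V UNIV X / X powr s) \<longlongrightarrow> \<kappa>) at_top"
  shows "((\<lambda>X. count_points V (rough_points m) X / X powr s)
    \<longlongrightarrow> \<kappa> * (\<Prod>p<m. euler_factor s p)) at_top"
proof (induction m)
  case 0
  then show ?case using lim by simp
next
  case (Suc m)
  show ?case
  proof (cases "prime m")
    case False
    then show ?thesis using Suc by (simp add: rough_points_Suc euler_factor_def)
  next
    case True
    have m: "m > 0" using True by (rule prime_gt_0_nat)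
    have AB: "(\<chi> i. int m * Q $ i) \<in> rough_points m \<longleftrightarrow> Q \<in> rough_points m" for Q :: "int ^ 'n"
      using True by (auto simp: rough_points_def prime_divides_point_mult)
    have "count_points V (rough_points (Suc m)) X =
        count_points V (rough_points m) X - count_points V (rough_points m) (X / real m)" for X
      using True count_points_split[of V "rough_points m" X "{P. divides_point m P}"]
        count_points_multiples[OF V m AB, of X] by (simp add: rough_points_Suc)
    then have "(\<lambda>X. count_points V (rough_points (Suc m)) X / X powr s) =
        (\<lambda>X. count_points V (rough_points m) X / X powr s
           - count_points V (rough_points m) (X / real m) / X powr s)"
      by (simp only: diff_divide_distrib)
    moreover have "((\<lambda>X. count_points V (rough_points m) X / X powr s -
         count_points V (rough_points m) (X / real m) / X powr s) \<longlongrightarrow>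
       \<kappa> * (\<Prod>p<m. euler_factor s p) - real m powr (- s) * (\<kappa> * (\<Prod>p<m. euler_factor s p))) at_top"
      by (intro tendsto_diff Suc rescaled_growth m)
    moreover have "\<kappa> * (\<Prod>p<m. euler_factor s p) - real m powr (- s) * (\<kappa> * (\<Prod>p<m. euler_factor s p))
        = \<kappa> * (\<Prod>p<Suc m. euler_factor s p)"
      using True by (simp add: euler_factor_def algebra_simps)
    ultimately show ?thesis by simp
  qed
qed

text \<open>The asymptotic bound extends to all \<open>X > 0\<close> because there are no points of height below \<open>1\<close>. Validity
  for small \<open>X\<close> matters because the bound is applied at \<open>X / k\<close> with \<open>k\<close> as large as \<open>X\<close>.\<close>

lemma count_points_power_bound:
  fixes V :: "(rat ^ 'n) set"
  assumes lim: "((\<lambda>X. count_points V UNIV X / X powr s) \<longlongrightarrow> \<kappa>) at_top" and s: "s \<ge> 0"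
  obtains C where "C \<ge> 0" "\<And>X. X > 0 \<Longrightarrow> count_points V UNIV X \<le> C * X powr s"
proof -
  have "\<forall>\<^sub>F X in at_top. count_points V UNIV X / X powr s < \<kappa> + 1"
    using order_tendstoD(2)[OF lim, of "\<kappa> + 1"] by simp
  then obtain X0 where X0: "\<And>X. X \<ge> X0 \<Longrightarrow> count_points V UNIV X / X powr s < \<kappa> + 1"
    by (auto simp: eventually_at_top_linorder)
  \<comment> \<open>The first argument of the maximum serves \<open>1 \<le> X \<le> X0\<close>, the second one \<open>X > X0\<close>.\<close>
  define C where "C = max (count_points V UNIV X0) \<bar>\<kappa> + 1\<bar>"
  have C: "C \<ge> 0" "count_points V UNIV X0 \<le> C" "\<kappa> + 1 \<le> C" by (auto simp: C_def)
  have "count_points V UNIV X \<le> C * X powr s" if X: "X > 0" for X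
  proof (cases "X < 1")
    case True
    then show ?thesis using C by (simp add: count_points_eq_0)
  next
    case ge1: False
    show ?thesis
    proof (cases "X \<le> X0")
      case True
      have "1 \<le> X powr s" using ge1 s ge_one_powr_ge_zero by simp
      then have "C * 1 \<le> C * X powr s" using C by (intro mult_left_mono)
      then show ?thesis using count_points_mono[OF order_refl True, of V UNIV] C by simp
    next
      case False
      then have "count_points V UNIV X \<le> (\<kappa> + 1) * X powr s"
        using X0[of X] X by (simp add: field_simps)
      also have "\<dots> \<le> C * X powr s" using C by (intro mult_right_mono) auto
      finally show ?thesis .
    qed
  qed
  with C(1) that show thesis by blast
qed

text \<open>A point that survives the sieve up to \<open>m\<close> but is not primitive is divisible by some prime \<open>p \<ge> m\<close>.
  Bounding over all \<open>k \<ge> m\<close> instead of primes is wasteful, but the series still converges because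
  \<open>s > 1\<close>.\<close>

lemma rough_minus_primitive_le:
  fixes V :: "(rat ^ 'n) set"
  assumes V: "is_cone V" and s: "1 < s" and m: "m > 0" and X: "X > 0" and C: "C \<ge> 0"
    and bound: "\<And>X. X > 0 \<Longrightarrow> count_points V UNIV X \<le> C * X powr s"
  shows "count_points V (rough_points m) X - count_points V primitive_points X
    \<le> C * X powr s * (\<Sum>k. real (k + m) powr (- s))"
proof -
  let ?S = "\<lambda>A. {P \<in> branch_locus V \<inter> A. real_of_int (height P) \<le> X}"
  let ?K = "nat \<lfloor>X\<rfloor>"
  have "rough_points m \<inter> primitive_points = (primitive_points :: (int ^ 'n) set)"
    using primitive_subset_rough by blast
  then have "count_points V (rough_points m) X - count_points V primitive_points X
      = real (card (?S (rough_points m - primitive_points)))"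
    using count_points_split[of V "rough_points m" X primitive_points] by (simp add: count_points_def)
  also have "card (?S (rough_points m - primitive_points))
      \<le> card (\<Union>k\<le>?K. ?S (UNIV \<inter> {P. divides_point (k + m) P}))"
  proof (rule card_mono)
    show "finite (\<Union>k\<le>?K. ?S (UNIV \<inter> {P. divides_point (k + m) P}))"
      using finite_points_bounded_height by blast
    show "?S (rough_points m - primitive_points) \<subseteq> (\<Union>k\<le>?K. ?S (UNIV \<inter> {P. divides_point (k + m) P}))"
    proof
      fix P assume P: "P \<in> ?S (rough_points m - primitive_points)"
      then obtain p where p: "prime p" "divides_point p P" by (auto simp: primitive_points_def)
      with P have "m \<le> p" by (auto simp: rough_points_def)
      \<comment> \<open>A divisor of \<open>P\<close> is at most its height, so finitely many \<open>k\<close> cover all cases.\<close>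
      fix i0 :: 'n
      have "int p \<le> P $ i0"
        using p P by (intro zdvd_imp_le) (auto simp: divides_point_def branch_locus_def)
      also have "P $ i0 \<le> \<lfloor>X\<rfloor>"
        using P by (auto simp: height_le_iff le_floor_iff dest: abs_le_D1)
      finally have "p \<le> ?K" by linarith
      then have "p - m \<in> {..?K}" by simp
      moreover have "P \<in> ?S (UNIV \<inter> {P. divides_point (p - m + m) P})"
        using P p \<open>m \<le> p\<close> by simp
      ultimately show "P \<in> (\<Union>k\<le>?K. ?S (UNIV \<inter> {P. divides_point (k + m) P}))" by blast
    qed
  qed
  also have "\<dots> \<le> (\<Sum>k\<le>?K. card (?S (UNIV \<inter> {P. divides_point (k + m) P})))"
    by (rule card_UN_le) simp
  also have "real \<dots> = (\<Sum>k\<le>?K. count_points V UNIV (X / real (k + m)))"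
    using m by (simp only: of_nat_sum, intro sum.cong refl)
      (subst count_points_multiples[OF V, symmetric, where A = UNIV], auto simp: count_points_def)
  also have "\<dots> \<le> (\<Sum>k\<le>?K. C * X powr s * real (k + m) powr (- s))"
  proof (rule sum_mono)
    fix k
    have "count_points V UNIV (X / real (k + m)) \<le> C * (X / real (k + m)) powr s"
      using X m by (intro bound) simp
    also have "\<dots> = C * X powr s * real (k + m) powr (- s)"
      using X m by (simp add: powr_divide powr_minus field_simps)
    finally show "count_points V UNIV (X / real (k + m)) \<le> C * X powr s * real (k + m) powr (- s)" .
  qed
  also have "\<dots> = C * X powr s * (\<Sum>k\<le>?K. real (k + m) powr (- s))" by (simp add: sum_distrib_left)
  also have "\<dots> \<le> C * X powr s * (\<Sum>k. real (k + m) powr (- s))"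
    using C summable_ignore_initial_segment[OF summable_powr_neg[OF s], of m]
    by (intro mult_left_mono sum_le_suminf) auto
  finally show ?thesis by simp
qed

text \<open>The error made by sieving only up to \<open>m\<close> is, relative to \<open>X powr s\<close>, bounded uniformly in \<open>X\<close> by a quantity
  that tends to \<open>0\<close> with growing \<open>m\<close>. This justifies exchanging the limits in \<open>X\<close> and \<open>m\<close>.\<close>

lemma primitive_points_growth:
  fixes V :: "(rat ^ 'n) set"
  assumes V: "is_cone V" and s: "1 < s"
    and lim: "((\<lambda>X. count_points V UNIV X / X powr s) \<longlongrightarrow> \<kappa>) at_top"
  shows "((\<lambda>X. count_points V primitive_points X / X powr s) \<longlongrightarrow> \<kappa> / zeta s) at_top"
proof (rule tendstoI)
  fix e :: real assume e: "e > 0"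
  obtain C where C: "C \<ge> 0" "\<And>X. X > 0 \<Longrightarrow> count_points V UNIV X \<le> C * X powr s"
    using count_points_power_bound[OF lim] s by auto
  have "(\<lambda>m. \<kappa> * (\<Prod>p<m. euler_factor s p)) \<longlonglongrightarrow> \<kappa> / zeta s"
    using tendsto_mult[OF tendsto_const[of \<kappa>] euler_product_tendsto[OF s]] by simp
  then have "\<forall>\<^sub>F m in sequentially. dist (\<kappa> * (\<Prod>p<m. euler_factor s p)) (\<kappa> / zeta s) < e / 3"
    using e by (intro tendstoD) auto
  moreover have "(\<lambda>m. C * (\<Sum>k. real (k + m) powr (- s))) \<longlonglongrightarrow> 0"
    using tendsto_mult[OF tendsto_const[of C] powr_tail_tendsto_0[OF s]] by simp
  then have "\<forall>\<^sub>F m in sequentially. C * (\<Sum>k. real (k + m) powr (- s)) < e / 3"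
    using e by (intro order_tendstoD) auto
  ultimately have "\<forall>\<^sub>F m in sequentially. m > 0 \<and>
      dist (\<kappa> * (\<Prod>p<m. euler_factor s p)) (\<kappa> / zeta s) < e / 3 \<and>
      C * (\<Sum>k. real (k + m) powr (- s)) < e / 3"
    using eventually_gt_at_top[of 0] by eventually_elim blast
  then obtain m where m: "m > 0" "dist (\<kappa> * (\<Prod>p<m. euler_factor s p)) (\<kappa> / zeta s) < e / 3"
      "C * (\<Sum>k. real (k + m) powr (- s)) < e / 3"
    by (auto dest: eventually_happens)
  have "\<forall>\<^sub>F X in at_top. dist (count_points V (rough_points m) X / X powr s)
      (\<kappa> * (\<Prod>p<m. euler_factor s p)) < e / 3"
    using e by (intro tendstoD[OF rough_points_growth[OF V lim]]) simp
  then show "\<forall>\<^sub>F X in at_top. dist (count_points V primitive_points X / X powr s) (\<kappa> / zeta s) < e"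
    using eventually_gt_at_top[of 0]
  proof eventually_elim
    case (elim X)
    have "count_points V (rough_points m) X - count_points V primitive_points X
        \<le> C * X powr s * (\<Sum>k. real (k + m) powr (- s))"
      by (rule rough_minus_primitive_le[OF V s m(1) elim(2) C])
    then have "count_points V (rough_points m) X / X powr s - count_points V primitive_points X / X powr s
        \<le> C * (\<Sum>k. real (k + m) powr (- s))"
      using elim(2) by (simp add: field_simps)
    moreover have "count_points V primitive_points X / X powr s
        \<le> count_points V (rough_points m) X / X powr s"
      using elim(2) by (intro divide_right_mono count_points_mono primitive_subset_rough) auto
    ultimately show ?case using elim(1) m(2,3) unfolding dist_real_def by linarith
  qed
qed

section \<open>Densities of visible points on a cone\<close>

lemma has_density_of_growth:
  fixes V :: "(rat ^ 'n) set"
  assumes "((\<lambda>X. count_points V A X / X powr s) \<longlongrightarrow> \<kappa> * d) at_top"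
    and "((\<lambda>X. count_points V UNIV X / X powr s) \<longlongrightarrow> \<kappa>) at_top" and \<kappa>: "\<kappa> \<noteq> 0"
  shows "has_density V (branch_locus V \<inter> A) d"
proof -
  have "((\<lambda>X. (count_points V A X / X powr s) / (count_points V UNIV X / X powr s)) \<longlongrightarrow> \<kappa> * d / \<kappa>) at_top"
    by (intro tendsto_divide assms)
  moreover have "\<forall>\<^sub>F X in at_top. (count_points V A X / X powr s) / (count_points V UNIV X / X powr s)
      = proportion V (branch_locus V \<inter> A) X"
    using eventually_gt_at_top[of 0]
    by eventually_elim (simp add: proportion_def count_points_def Int_assoc[symmetric])
  ultimately show ?thesis unfolding has_density_def using \<kappa>
    by (auto dest: Lim_transform_eventually)
qed

lemma Lim_of_has_density:
  "has_density V A d \<Longrightarrow> Lim at_top (proportion V A) = d"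
  unfolding has_density_def by (rule tendsto_Lim) simp

theorem has_density_globally_visible:
  fixes V :: "(rat ^ 'n) set"
  assumes "is_cone V" "1 < s" "is_ray_choice V rep"
    and "((\<lambda>X. count_points V UNIV X / X powr s) \<longlongrightarrow> \<kappa>) at_top" and "\<kappa> \<noteq> 0"
  shows "has_density V (globally_visible_points V rep) (1 / zeta s)"
proof -
  have "globally_visible_points V rep = branch_locus V \<inter> primitive_points"
    using globally_visible_points_eq[OF assms(3)] by (auto simp: primitive_points_def)
  then show ?thesis
    using has_density_of_growth[of V primitive_points s \<kappa> "1 / zeta s"]
      primitive_points_growth[OF assms(1,2,4)] assms(4,5) by simp
qed

text \<open>The invisible points are those divisible by \<open>p\<close>, and there are as many of them up to height \<open>X\<close> as
  there are points up to height \<open>X / p\<close>.\<close>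

theorem has_density_padically_visible:
  fixes V :: "(rat ^ 'n) set"
  assumes V: "is_cone V" and "is_ray_choice V rep" and p: "prime p"
    and lim: "((\<lambda>X. count_points V UNIV X / X powr s) \<longlongrightarrow> \<kappa>) at_top" and "\<kappa> \<noteq> 0"
  shows "has_density V (padically_visible_points V rep p) (1 - real p powr (- s))"
proof -
  let ?A = "- {P :: int ^ 'n. divides_point p P}"
  have p0: "p > 0" using p by (rule prime_gt_0_nat)
  have "count_points V ?A X = count_points V UNIV X - count_points V UNIV (X / real p)" for X
    using count_points_split[of V UNIV X "{P. divides_point p P}"]
      count_points_multiples[OF V p0, of UNIV UNIV X] by (simp add: Compl_eq_Diff_UNIV)
  moreover have "((\<lambda>X. count_points V UNIV X / X powr s - count_points V UNIV (X / real p) / X powr s)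
      \<longlongrightarrow> \<kappa> - real p powr (- s) * \<kappa>) at_top"
    by (intro tendsto_diff lim rescaled_growth p0)
  ultimately have "((\<lambda>X. count_points V ?A X / X powr s) \<longlongrightarrow> \<kappa> - real p powr (- s) * \<kappa>) at_top"
    by (simp only: diff_divide_distrib)
  then have "((\<lambda>X. count_points V ?A X / X powr s) \<longlongrightarrow> \<kappa> * (1 - real p powr (- s))) at_top"
    by (simp add: algebra_simps)
  then have "has_density V (branch_locus V \<inter> ?A) (1 - real p powr (- s))"
    by (rule has_density_of_growth) fact+
  moreover have "padically_visible_points V rep p = branch_locus V \<inter> ?A"
    using padically_visible_points_eq[OF assms(2) p] by auto
  ultimately show ?thesis by simp
qed

section \<open>Parametrization of the Veronese cone\<close>

text \<open>For each prime, the multiplicities in \<open>d\<close> and in \<open>e\<close> are \<open>0\<close> or \<open>1\<close>, and their sum is even. The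
  factor \<open>r\<^sup>2\<close> is there because in the applications it is a product of two numbers with squarefree
  parts \<open>d\<close> and \<open>e\<close> that is known to be a square.\<close>

lemma squarefree_eq_if_mult_square:
  fixes d e r z :: nat
  assumes "squarefree d" "squarefree e" "r > 0" "d * e * r\<^sup>2 = z\<^sup>2"
  shows "d = e"
proof (rule multiplicity_eq_nat)
  have d: "d \<noteq> 0" "e \<noteq> 0" using assms(1,2) by (auto intro!: Nat.gr0I)
  then show "d > 0" "e > 0" by auto
  have z: "z \<noteq> 0" using assms(3,4) d by (auto intro!: Nat.gr0I)
  fix p :: nat assume p: "prime p"
  have "multiplicity p (d * e * r\<^sup>2) = multiplicity p d + multiplicity p e + 2 * multiplicity p r"
    using p d assms(3)
    by (simp add: prime_elem_multiplicity_mult_distrib prime_elem_multiplicity_power_distrib)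
  moreover have "multiplicity p (z\<^sup>2) = 2 * multiplicity p z"
    using p z by (simp add: prime_elem_multiplicity_power_distrib)
  ultimately have "multiplicity p d + multiplicity p e + 2 * multiplicity p r = 2 * multiplicity p z"
    using assms(4) by simp
  then have "even (multiplicity p d + multiplicity p e)" by presburger
  moreover have "multiplicity p d \<le> 1" "multiplicity p e \<le> 1"
    using assms(1,2) d p squarefree_factorial_semiring'' by blast+
  ultimately show "multiplicity p d = multiplicity p e" by presburger
qed

lemma squarefree_part_eq_if_mult_square:
  fixes x y z :: nat
  assumes "x > 0" "y > 0" "x * y = z\<^sup>2"
  shows "squarefree_part x = squarefree_part y"
proof (rule squarefree_eq_if_mult_square[where r = "square_part x * square_part y" and z = z])
  show "squarefree_part x * squarefree_part y * (square_part x * square_part y)\<^sup>2 = z\<^sup>2"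
    unfolding assms(3)[symmetric]
    by (subst (5) squarefree_decompose, subst (6) squarefree_decompose)
      (simp add: power_mult_distrib ac_simps)
  show "square_part x * square_part y > 0" using assms by (auto intro!: Nat.gr0I)
qed auto

lemma exhaust_6:
  fixes x :: 6
  shows "x = 1 \<or> x = 2 \<or> x = 3 \<or> x = 4 \<or> x = 5 \<or> x = 6"
proof (induct x)
  case (of_int z)
  then have "z = 0 \<or> z = 1 \<or> z = 2 \<or> z = 3 \<or> z = 4 \<or> z = 5" by fastforce
  then show ?case by auto
qed

lemma forall_6: "(\<forall>i::6. P i) \<longleftrightarrow> P 1 \<and> P 2 \<and> P 3 \<and> P 4 \<and> P 5 \<and> P 6"
  by (metis exhaust_6)

text \<open>The symmetric matrix \<open>d u u\<^sup>T\<close> for \<open>u = (a, b, c)\<close>.\<close>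

definition veronese_point :: "nat \<times> nat \<times> nat \<times> nat \<Rightarrow> int ^ 6" where
  "veronese_point = (\<lambda>(d, a, b, c). \<chi> i. int (
     if i = 1 then d * a\<^sup>2 else if i = 2 then d * b\<^sup>2 else if i = 3 then d * c\<^sup>2
     else if i = 4 then d * a * b else if i = 5 then d * a * c else d * b * c))"

lemma veronese_point_nth [simp]:
  "veronese_point (d, a, b, c) $ 1 = int (d * a\<^sup>2)"
  "veronese_point (d, a, b, c) $ 2 = int (d * b\<^sup>2)"
  "veronese_point (d, a, b, c) $ 3 = int (d * c\<^sup>2)"
  "veronese_point (d, a, b, c) $ 4 = int (d * a * b)"
  "veronese_point (d, a, b, c) $ 5 = int (d * a * c)"
  "veronese_point (d, a, b, c) $ 6 = int (d * b * c)"
  by (simp_all add: veronese_point_def)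

lemma minor2_eq: "minor2 M i j k l = M $ i $ k * M $ j $ l - M $ i $ l * M $ j $ k"
  by (simp add: minor2_def det_2)

text \<open>Of the vanishing minors only the three principal ones are recorded: for positive entries they
  determine the off-diagonal entries from the diagonal.\<close>

lemma veronese_coneD:
  assumes "x \<in> veronese_cone"
  shows "x $ 1 * x $ 2 = (x $ 4)\<^sup>2" "x $ 1 * x $ 3 = (x $ 5)\<^sup>2" "x $ 2 * x $ 3 = (x $ 6)\<^sup>2"
proof -
  have m: "minor2 (sym_matrix x) i j i j = 0" if "i \<noteq> j" for i j
    using assms that by (auto simp: veronese_cone_def)
  show "x $ 1 * x $ 2 = (x $ 4)\<^sup>2" "x $ 1 * x $ 3 = (x $ 5)\<^sup>2" "x $ 2 * x $ 3 = (x $ 6)\<^sup>2"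
    using m[of 1 2] m[of 1 3] m[of 2 3]
    by (simp_all add: minor2_eq sym_matrix_def vector_3 power2_eq_square)
qed

lemma veronese_coneI:
  assumes "\<And>i j. sym_matrix x $ i $ j = d * u i * u j"
  shows "x \<in> veronese_cone"
  by (simp add: veronese_cone_def minor2_eq assms)

lemma is_cone_veronese: "is_cone veronese_cone"
proof -
  have "sym_matrix (c *s x) $ i $ j = c * sym_matrix x $ i $ j" for c x i j
    using exhaust_3[of i] exhaust_3[of j] by (auto simp: sym_matrix_def vector_3)
  then have "minor2 (sym_matrix (c *s x)) i j k l = c\<^sup>2 * minor2 (sym_matrix x) i j k l" for c x i j k l
    by (simp add: minor2_eq power2_eq_square algebra_simps)
  then show ?thesis by (simp add: is_cone_def veronese_cone_def)
qed

lemma veronese_point_in_cone: "rat_point (veronese_point (d, a, b, c)) \<in> veronese_cone"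
proof (rule veronese_coneI)
  fix i j :: 3
  let ?u = "\<lambda>i::3. if i = 1 then of_nat a else if i = 2 then of_nat b else of_nat c :: rat"
  show "sym_matrix (rat_point (veronese_point (d, a, b, c))) $ i $ j = of_nat d * ?u i * ?u j"
    using exhaust_3[of i] exhaust_3[of j]
    by (auto simp: sym_matrix_def vector_3 rat_point_def power2_eq_square)
qed

text \<open>The principal minors make the product of any two diagonal entries a square, so the three have the same
  squarefree part \<open>d\<close>; writing them as \<open>d a\<^sup>2\<close>, \<open>d b\<^sup>2\<close>, \<open>d c\<^sup>2\<close>, the off-diagonal entries are
  the positive square roots \<open>d a b\<close>, \<open>d a c\<close>, \<open>d b c\<close>.\<close>

lemma branch_locus_veronese:
  "branch_locus veronese_cone =
   veronese_point ` {(d, a, b, c). squarefree d \<and> a > 0 \<and> b > 0 \<and> c > 0}"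
proof (intro set_eqI iffI)
  fix P :: "int ^ 6" assume P: "P \<in> branch_locus veronese_cone"
  define x where "x i = nat (P $ i)" for i
  have Px: "P $ i = int (x i)" and pos: "x i > 0" for i
    using P by (simp_all add: branch_locus_def x_def less_imp_le)
  have "rat_point P \<in> veronese_cone" using P by (simp add: branch_locus_def)
  from veronese_coneD[OF this]
  have "(of_nat (x 1 * x 2) :: rat) = of_nat ((x 4)\<^sup>2)" "(of_nat (x 1 * x 3) :: rat) = of_nat ((x 5)\<^sup>2)"
    "(of_nat (x 2 * x 3) :: rat) = of_nat ((x 6)\<^sup>2)"
    by (simp_all add: rat_point_def Px)
  then have sq: "x 1 * x 2 = (x 4)\<^sup>2" "x 1 * x 3 = (x 5)\<^sup>2" "x 2 * x 3 = (x 6)\<^sup>2"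
    by (simp_all only: of_nat_eq_iff)
  define d where "d = squarefree_part (x 1)"
  define a b c where "a = square_part (x 1)" and "b = square_part (x 2)" and "c = square_part (x 3)"
  have abc: "a > 0" "b > 0" "c > 0"
    using pos[of 1] pos[of 2] pos[of 3] by (auto simp: a_def b_def c_def intro!: Nat.gr0I)
  have diag: "x 1 = d * a\<^sup>2" "x 2 = d * b\<^sup>2" "x 3 = d * c\<^sup>2"
    using squarefree_decompose[of "x 1"] squarefree_decompose[of "x 2"] squarefree_decompose[of "x 3"]
      squarefree_part_eq_if_mult_square[OF pos pos sq(1)]
      squarefree_part_eq_if_mult_square[OF pos pos sq(2)]
    unfolding a_def b_def c_def d_def by argo+
  have root: "z = d * r * t" if "d * r\<^sup>2 * (d * t\<^sup>2) = z\<^sup>2" for r t z :: nat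
  proof (rule power_eq_imp_eq_base[of _ 2])
    show "z\<^sup>2 = (d * r * t)\<^sup>2" using that by (simp add: power2_eq_square ac_simps)
  qed auto
  have off: "x 4 = d * a * b" "x 5 = d * a * c" "x 6 = d * b * c"
    by (rule root, use sq in \<open>simp add: diag\<close>)+
  have "\<forall>i. P $ i = veronese_point (d, a, b, c) $ i"
    unfolding forall_6 veronese_point_nth Px diag off by simp
  then have "P = veronese_point (d, a, b, c)" by (simp add: vec_eq_iff)
  moreover have "squarefree d" by (simp add: d_def squarefree_squarefree_part)
  ultimately show "P \<in> veronese_point ` {(d, a, b, c). squarefree d \<and> a > 0 \<and> b > 0 \<and> c > 0}"
    using abc by blast
next
  fix P assume "P \<in> veronese_point ` {(d, a, b, c). squarefree d \<and> a > 0 \<and> b > 0 \<and> c > 0}"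
  then obtain d a b c where P: "P = veronese_point (d, a, b, c)" and pos: "squarefree d" "a > 0" "b > 0" "c > 0"
    by blast
  have "d > 0" using pos(1) by (auto intro!: Nat.gr0I)
  then have "\<forall>i. P $ i > 0" using pos unfolding forall_6 P veronese_point_nth by simp
  then show "P \<in> branch_locus veronese_cone"
    using veronese_point_in_cone by (simp add: branch_locus_def P)
qed

lemma inj_on_veronese_point:
  "inj_on veronese_point {(d, a, b, c). squarefree d \<and> a > 0 \<and> b > 0 \<and> c > 0}"
proof (rule inj_onI)
  fix t t' :: "nat \<times> nat \<times> nat \<times> nat"
  assume U: "t \<in> {(d, a, b, c). squarefree d \<and> a > 0 \<and> b > 0 \<and> c > 0}"
    "t' \<in> {(d, a, b, c). squarefree d \<and> a > 0 \<and> b > 0 \<and> c > 0}"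
    and "veronese_point t = veronese_point t'"
  moreover obtain d a b c d' a' b' c' where t: "t = (d, a, b, c)" "t' = (d', a', b', c')"
    by (metis prod_cases4)
  ultimately have sf: "squarefree d" "squarefree d'" and pos: "a' > 0"
    and eq: "veronese_point (d, a, b, c) = veronese_point (d', a', b', c')" by auto
  have diag: "d * a\<^sup>2 = d' * a'\<^sup>2" "d * b\<^sup>2 = d' * b'\<^sup>2" "d * c\<^sup>2 = d' * c'\<^sup>2"
    using arg_cong[OF eq, of "\<lambda>P. P $ 1"] arg_cong[OF eq, of "\<lambda>P. P $ 2"] arg_cong[OF eq, of "\<lambda>P. P $ 3"]
    unfolding veronese_point_nth of_nat_eq_iff by blast+
  have "d = d'"
  proof (rule squarefree_eq_if_mult_square[OF sf pos])
    have "d * d' * a'\<^sup>2 = d * (d * a\<^sup>2)" using diag(1) by (simp add: ac_simps)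
    then show "d * d' * a'\<^sup>2 = (d * a)\<^sup>2" by (simp add: power2_eq_square ac_simps)
  qed
  moreover have "d > 0" using sf(1) by (auto intro!: Nat.gr0I)
  ultimately show "t = t'" using diag by (simp add: t)
qed

text \<open>The largest entry of \<open>d u u\<^sup>T\<close> is on the diagonal, so the height condition bounds the
  entries of \<open>u\<close> independently of each other.\<close>

lemma height_veronese_point_le_iff:
  assumes d: "d > 0" and X: "X \<ge> 0"
  shows "real_of_int (height (veronese_point (d, a, b, c))) \<le> X \<longleftrightarrow>
    (let r = nat \<lfloor>sqrt (X / real d)\<rfloor> in a \<le> r \<and> b \<le> r \<and> c \<le> r)"
proof -
  have r: "a \<le> nat \<lfloor>sqrt (X / real d)\<rfloor> \<longleftrightarrow> real (d * a\<^sup>2) \<le> X" for a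
  proof -
    have "a \<le> nat \<lfloor>sqrt (X / real d)\<rfloor> \<longleftrightarrow> real a \<le> sqrt (X / real d)"
      using X by (simp add: le_nat_iff le_floor_iff)
    also have "\<dots> \<longleftrightarrow> (real a)\<^sup>2 \<le> X / real d"
      by (metis real_sqrt_le_iff real_sqrt_abs2 power2_eq_square abs_of_nat)
    also have "\<dots> \<longleftrightarrow> real (d * a\<^sup>2) \<le> X" using d by (simp add: field_simps)
    finally show ?thesis .
  qed
  have off: "real (d * a * b) \<le> X" if "real (d * a\<^sup>2) \<le> X" "real (d * b\<^sup>2) \<le> X" for a b
  proof -
    have "d * a * b \<le> d * (max a b)\<^sup>2"
      by (simp add: power2_eq_square mult.assoc mult_le_mono)
    then have "real (d * a * b) \<le> real (d * (max a b)\<^sup>2)" by (rule of_nat_mono)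
    also have "\<dots> \<le> X" using that by (simp add: max_def)
    finally show ?thesis .
  qed
  have "real_of_int (height (veronese_point (d, a, b, c))) \<le> X \<longleftrightarrow>
      real (d * a\<^sup>2) \<le> X \<and> real (d * b\<^sup>2) \<le> X \<and> real (d * c\<^sup>2) \<le> X \<and>
      real (d * a * b) \<le> X \<and> real (d * a * c) \<le> X \<and> real (d * b * c) \<le> X"
    unfolding height_le_iff forall_6 veronese_point_nth by (simp only: abs_of_nat of_int_of_nat_eq)
  also have "\<dots> \<longleftrightarrow> real (d * a\<^sup>2) \<le> X \<and> real (d * b\<^sup>2) \<le> X \<and> real (d * c\<^sup>2) \<le> X"
    using off by blast
  finally show ?thesis unfolding r Let_def .
qed

text \<open>For each \<open>d\<close> the vectors \<open>u\<close> fill a cube of side \<open>\<lfloor>\<surd>(X / d)\<rfloor>\<close>. The cube is empty for \<open>d > X\<close>, so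
  the series is a finite sum; as a series over all \<open>d\<close> it is open to dominated convergence.\<close>

lemma count_points_veronese:
  assumes X: "X > 0"
  shows "count_points veronese_cone UNIV X =
    (\<Sum>d. if squarefree d then real (nat \<lfloor>sqrt (X / real d)\<rfloor>) ^ 3 else 0)"
proof -
  define r where "r d = nat \<lfloor>sqrt (X / real d)\<rfloor>" for d
  define D where "D = {d \<in> {..nat \<lfloor>X\<rfloor>}. squarefree d}"
  let ?T = "SIGMA d:D. {1..r d} \<times> {1..r d} \<times> {1..r d}"
  have r0: "r d = 0" if "squarefree d" "d \<notin> D" for d
  proof -
    have "X < real d" using that X by (simp add: D_def) linarith
    then have "sqrt (X / real d) < 1" using X by simp
    then have "\<lfloor>sqrt (X / real d)\<rfloor> < 1" by (simp only: floor_less_one)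
    then show ?thesis by (simp add: r_def)
  qed
  let ?U = "{(d, a, b, c). squarefree d \<and> a > 0 \<and> b > 0 \<and> (c::nat) > 0}"
  have T: "?T = {t \<in> ?U. real_of_int (height (veronese_point t)) \<le> X}"
  proof (intro set_eqI)
    fix t :: "nat \<times> nat \<times> nat \<times> nat"
    obtain d a b c where t: "t = (d, a, b, c)" by (metis prod_cases4)
    show "t \<in> ?T \<longleftrightarrow> t \<in> {t \<in> ?U. real_of_int (height (veronese_point t)) \<le> X}"
    proof (cases "squarefree d")
      case True
      then have "d > 0" by (auto intro!: Nat.gr0I)
      have *: "real_of_int (height (veronese_point (d, a, b, c))) \<le> X \<longleftrightarrow> a \<le> r d \<and> b \<le> r d \<and> c \<le> r d"
        using height_veronese_point_le_iff[OF \<open>d > 0\<close>, of X a b c] X by (simp add: r_def Let_def)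
      show ?thesis using True r0[OF True] unfolding t by (cases "d \<in> D") (auto simp: *)
    qed (auto simp: t D_def)
  qed
  have "{P \<in> branch_locus veronese_cone \<inter> UNIV. real_of_int (height P) \<le> X} = veronese_point ` ?T"
    unfolding T branch_locus_veronese by blast
  moreover have "inj_on veronese_point ?T"
    by (rule inj_on_subset[OF inj_on_veronese_point]) (unfold T, blast)
  ultimately have "count_points veronese_cone UNIV X = real (card ?T)"
    by (simp only: count_points_def card_image)
  also have "\<dots> = (\<Sum>d\<in>D. real (r d) ^ 3)"
    by (simp add: D_def card_SigmaI power3_eq_cube mult.assoc)
  also have "\<dots> = (\<Sum>d\<in>D. if squarefree d then real (r d) ^ 3 else 0)"
    by (rule sum.cong) (auto simp: D_def)
  also have "\<dots> = (\<Sum>d. if squarefree d then real (r d) ^ 3 else 0)"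
    by (rule suminf_finite[symmetric]) (auto simp: D_def r0[unfolded D_def])
  finally show ?thesis by (simp only: r_def)
qed

section \<open>Growth of the point count on the Veronese cone\<close>

lemma floor_div_tendsto_1: "((\<lambda>Y::real. real (nat \<lfloor>Y\<rfloor>) / Y) \<longlongrightarrow> 1) at_top"
proof (rule tendsto_sandwich)
  show "\<forall>\<^sub>F Y in at_top. 1 - inverse Y \<le> real (nat \<lfloor>Y\<rfloor>) / Y"
    using eventually_gt_at_top[of 0]
  proof eventually_elim
    case (elim Y)
    have "1 - inverse Y = (Y - 1) / Y" using elim by (simp add: field_simps)
    also have "\<dots> \<le> real (nat \<lfloor>Y\<rfloor>) / Y" using elim by (intro divide_right_mono) linarith+
    finally show ?case .
  qed
  show "\<forall>\<^sub>F Y in at_top. real (nat \<lfloor>Y\<rfloor>) / Y \<le> 1"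
    using eventually_gt_at_top[of 0] by eventually_elim simp
  show "((\<lambda>Y::real. 1 - inverse Y) \<longlongrightarrow> 1) at_top"
    using tendsto_diff[OF tendsto_const[of 1] tendsto_inverse_0_at_top[OF filterlim_ident]] by simp
qed simp

lemma sqrt_cube_eq:
  assumes "X > 0" "d > 0"
  shows "sqrt (X / d) ^ 3 / X powr (3/2) = d powr (- (3/2))"
proof -
  have "sqrt (X / d) ^ 3 = ((X / d) powr (1/2)) powr 3"
    using assms powr_realpow[of "sqrt (X / d)" 3] by (simp add: powr_half_sqrt)
  also have "\<dots> = X powr (3/2) / d powr (3/2)"
    using assms by (simp add: powr_powr powr_divide)
  finally show ?thesis using assms by (simp add: powr_minus field_simps)
qed

text \<open>Divided by \<open>X powr (3/2)\<close>, the summand for \<open>d\<close> tends to \<open>d powr (- (3/2))\<close> and never exceeds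
  it, so Tannery's theorem applies. The limit is positive because of the term \<open>d = 1\<close>.\<close>

lemma count_points_veronese_growth:
  obtains \<kappa> where "\<kappa> > 0"
    "((\<lambda>X. count_points veronese_cone UNIV X / X powr (3/2)) \<longlongrightarrow> \<kappa>) at_top"
proof -
  define r where "r X d = nat \<lfloor>sqrt (X / real d)\<rfloor>" for X d
  define a where "a d X = (if squarefree d then real (r X d) ^ 3 / X powr (3/2) else 0)" for d X
  define b where "b d = (if squarefree d then real d powr (- (3/2)) else 0)" for d :: nat
  have sm: "summable (\<lambda>d. real d powr (- (3/2)))" by (rule summable_powr_neg) simp
  have lim: "((\<lambda>X. a d X) \<longlongrightarrow> b d) at_top" for d
  proof (cases "squarefree d")
    case True
    then have d: "d > 0" by (auto intro!: Nat.gr0I)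
    have "filterlim (\<lambda>X. X * (1 / real d)) at_top at_top"
      using d by (intro filterlim_at_top_mult_tendsto_pos[OF tendsto_const] filterlim_ident) auto
    then have "filterlim (\<lambda>X. sqrt (X / real d)) at_top at_top"
      using filterlim_compose[OF sqrt_at_top] by simp
    from filterlim_compose[OF floor_div_tendsto_1 this]
    have "((\<lambda>X. (real (r X d) / sqrt (X / real d)) ^ 3 * real d powr (- (3/2)))
        \<longlongrightarrow> 1 ^ 3 * real d powr (- (3/2))) at_top"
      unfolding r_def by (intro tendsto_mult tendsto_power tendsto_const)
    moreover have "\<forall>\<^sub>F X in at_top. (real (r X d) / sqrt (X / real d)) ^ 3 * real d powr (- (3/2)) = a d X"
      using eventually_gt_at_top[of 0]
    proof eventually_elim
      case (elim X)
      then have "sqrt (X / real d) ^ 3 \<noteq> 0" using d by simp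
      then show ?case using True sqrt_cube_eq[OF elim, of "real d"] d
        by (simp add: a_def power_divide flip: sqrt_cube_eq[OF elim, of "real d"])
    qed
    ultimately show ?thesis using True by (simp add: b_def Lim_transform_eventually)
  qed (simp add: a_def b_def)
  have bound: "norm (a d X) \<le> real d powr (- (3/2))" if X: "X > 0" for d X
  proof (cases "squarefree d")
    case True
    then have d: "d > 0" by (auto intro!: Nat.gr0I)
    have "real (r X d) \<le> sqrt (X / real d)" using X by (simp add: r_def)
    then have "real (r X d) ^ 3 / X powr (3/2) \<le> sqrt (X / real d) ^ 3 / X powr (3/2)"
      by (intro divide_right_mono power_mono) auto
    then show ?thesis using True sqrt_cube_eq[OF X, of "real d"] d by (simp add: a_def)
  qed (simp add: a_def)
  have "\<forall>\<^sub>F (d, X) in at_top \<times>\<^sub>F at_top. norm (a d X) \<le> real d powr (- (3/2))"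
  proof -
    have "\<forall>\<^sub>F (d, X) in (at_top :: nat filter) \<times>\<^sub>F at_top. X > (0::real)"
      by (subst eventually_prod2) (auto simp: eventually_gt_at_top)
    then show ?thesis by (rule eventually_mono) (use bound in auto)
  qed
  from tannerys_theorem[OF lim this sm]
  have "((\<lambda>X. \<Sum>d. a d X) \<longlongrightarrow> suminf b) at_top" by simp
  moreover have "\<forall>\<^sub>F X in at_top. (\<Sum>d. a d X) = count_points veronese_cone UNIV X / X powr (3/2)"
    using eventually_gt_at_top[of 0]
  proof eventually_elim
    case (elim X)
    have "summable (\<lambda>d. if squarefree d then real (r X d) ^ 3 else 0)"
    proof (rule summable_comparison_test'[of "\<lambda>d. real d powr (- (3/2)) * X powr (3/2)" 0])
      show "summable (\<lambda>d. real d powr (- (3/2)) * X powr (3/2))" by (rule summable_mult2[OF sm])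
      show "norm (if squarefree d then real (r X d) ^ 3 else 0) \<le> real d powr (- (3/2)) * X powr (3/2)" for d
        using bound[OF elim, of d] elim by (auto simp: a_def field_simps)
    qed
    from suminf_divide[OF this, of "X powr (3/2)"]
    show ?case unfolding count_points_veronese[OF elim]
      by (simp add: a_def r_def if_distrib[of "\<lambda>x. x / _"] cong: if_cong)
  qed
  ultimately have "((\<lambda>X. count_points veronese_cone UNIV X / X powr (3/2)) \<longlongrightarrow> suminf b) at_top"
    by (rule Lim_transform_eventually)
  moreover have "suminf b > 0"
  proof (rule suminf_pos2[of _ 1])
    show "summable b" by (rule summable_comparison_test'[OF sm, of 0]) (auto simp: b_def)
  qed (auto simp: b_def)
  ultimately show thesis using that by blast
qed

section \<open>Visible points on the Veronese cone\<close>

theorem proposition4p13: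
  fixes rep :: "(rat ^ 6) set \<Rightarrow> rat ^ 6"
  assumes "is_ray_choice veronese_cone rep"
  shows "has_density veronese_cone (globally_visible_points veronese_cone rep) (1 / zeta (3 / 2))
    \<and> vis_density veronese_cone rep = 1 / zeta (3 / 2)
    \<and> (\<forall>p. prime p \<longrightarrow>
          has_density veronese_cone (padically_visible_points veronese_cone rep p)
            (1 - real p powr (- (3 / 2)))
        \<and> local_vis_density veronese_cone rep p = 1 - real p powr (- (3 / 2)))
    \<and> locally_detectable veronese_cone rep
    \<and> (\<lambda>p. if prime p then local_vis_density veronese_cone rep p else 1)
         has_prod vis_density veronese_cone rep"
proof -
  obtain \<kappa> where \<kappa>: "\<kappa> > 0"
    and lim: "((\<lambda>X. count_points veronese_cone UNIV X / X powr (3/2)) \<longlongrightarrow> \<kappa>) at_top"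
    by (rule count_points_veronese_growth)
  have glob: "has_density veronese_cone (globally_visible_points veronese_cone rep) (1 / zeta (3 / 2))"
    using \<kappa> by (intro has_density_globally_visible[OF is_cone_veronese _ assms lim]) auto
  have loc: "has_density veronese_cone (padically_visible_points veronese_cone rep p) (1 - real p powr (- (3 / 2)))"
    if "prime p" for p
    using \<kappa> by (intro has_density_padically_visible[OF is_cone_veronese assms that lim]) auto
  have vis: "vis_density veronese_cone rep = 1 / zeta (3 / 2)"
    unfolding vis_density_def by (rule Lim_of_has_density[OF glob])
  have lvis: "local_vis_density veronese_cone rep p = 1 - real p powr (- (3 / 2))" if "prime p" for p
    unfolding local_vis_density_def by (rule Lim_of_has_density[OF loc[OF that]])
  have "(\<lambda>p. if prime p then local_vis_density veronese_cone rep p else 1) = euler_factor (3/2)"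
    by (auto simp: euler_factor_def lvis)
  then have "(\<lambda>p. if prime p then local_vis_density veronese_cone rep p else 1)
      has_prod vis_density veronese_cone rep"
    using euler_product_has_prod[of "3/2"] vis by simp
  then show ?thesis using glob vis loc lvis locally_detectable_always by blast
qed

end
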